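(* Let $r\in\{0,1,2\}$, let $k\ge 1$ be an integer, and set $m_{k,r}=\left\lfloor\frac{4k+2r+8}{3}\right\rfloor$. Assume that $H_{k,r}(x)=G_k(x)F_{k+r}(x)$ is unimodal with a mode at $m_{k,r}$. Then every mode of $E_{k,r}(x)=x(1+2x)^{2k+r+3}$ lies in $\{m_{k,r},m_{k,r}+1\}$. Consequently $I(U_{k,r};x)=H_{k,r}(x)+E_{k,r}(x)$ is unimodal, with a mode in $\{m_{k,r},m_{k,r}+1\}$. (In particular, whichever of these two indices carries the larger coefficient of $I(U_{k,r};x)$ is a mode.)
   Context: Graphs are finite and simple. $I(G;x)=\sum_{j\ge0}s_j(G)x^j$ is the independence polynomial, where $s_j(G)$ counts independent sets of size $j$. A polynomial with nonnegative coefficients $(a_0,\dots,a_d)$ is unimodal with a mode at $m$ if $a_0\le\cdots\le a_m\ge\cdots\ge a_d$. For $t\ge 0$, $F_t(x)=(1+2x)^t+x(1+x)^t$; for $k\ge1$, $G_k(x)=F_4(x)(1+2x)^{k-1}+x(1+x)^kF_3(x)$. The tree $T_{3,m,n}$ has a root $v_0$ with exactly three children $v_1,v_2,v_3$; a $P_2$-arm at a vertex $v$ is a path $v\,a\,b$ with edges $va$, $ab$ and new vertices $a,b$; $v_1$ carries three $P_2$-arms $v_1a_{1,j}b_{1,j}$, $v_2$ carries $m$ $P_2$-arms $v_2a_{2,j}b_{2,j}$, $v_3$ carries $n$ $P_2$-arms $v_3a_{3,j}b_{3,j}$, and there are no other vertices or edges. $U_{k,r}$ is obtained from $T_{3,k,k+r}$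 by adding the edge $v_1a_{2,1}$. *)

theory Defs
  imports
    "HOL-Computational_Algebra.Polynomial"
    "Graph_Theory.Pair_Digraph"
begin

text \<open>
  Finite simple graphs are represented as in the Graph-Theory library, by the locale
  \<open>pair_graph\<close>: every undirected edge \<open>uv\<close> occurs as the two arcs \<open>(u, v)\<close> and \<open>(v, u)\<close>.
\<close>

definition independent_set :: "'a pair_pre_digraph \<Rightarrow> 'a set \<Rightarrow> bool" where
  "independent_set G S \<longleftrightarrow>
     S \<subseteq> pverts G \<and> (\<forall>u\<in>S. \<forall>v\<in>S. (u, v) \<notin> parcs G)"

definition num_independent_sets :: "'a pair_pre_digraph \<Rightarrow> nat \<Rightarrow> nat" where
  "num_independent_sets G j = card {S. independent_set G S \<and> card S = j}"

text \<open>
  For a finite graph no independent set has more than \<open>card (pverts G)\<close> elements, so the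
  sum below contains all nonzero terms.
\<close>

definition independence_poly :: "'a pair_pre_digraph \<Rightarrow> int poly" where
  "independence_poly G =
     (\<Sum>j\<le>card (pverts G). monom (int (num_independent_sets G j)) j)"

text \<open>
  The coefficient sequence \<open>(a\<^sub>0, \<dots>, a\<^sub>d)\<close> of \<open>p\<close> runs up to \<open>d = degree p\<close>, and a mode is an
  index of that sequence.
\<close>

definition unimodal_with_mode :: "int poly \<Rightarrow> nat \<Rightarrow> bool" where
  "unimodal_with_mode p m \<longleftrightarrow>
     (\<forall>i\<le>degree p. 0 \<le> coeff p i) \<and>
     m \<le> degree p \<and>
     (\<forall>i<m. coeff p i \<le> coeff p (Suc i)) \<and>
     (\<forall>i. m \<le> i \<and> i < degree p \<longrightarrow> coeff p (Suc i) \<le> coeff p i)"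

definition F_poly :: "nat \<Rightarrow> int poly" where
  "F_poly t = [:1, 2:] ^ t + [:0, 1:] * [:1, 1:] ^ t"

definition G_poly :: "nat \<Rightarrow> int poly" where
  "G_poly k = F_poly 4 * [:1, 2:] ^ (k - 1) + [:0, 1:] * [:1, 1:] ^ k * F_poly 3"

definition H_poly :: "nat \<Rightarrow> nat \<Rightarrow> int poly" where
  "H_poly k r = G_poly k * F_poly (k + r)"

definition E_poly :: "nat \<Rightarrow> nat \<Rightarrow> int poly" where
  "E_poly k r = [:0, 1:] * [:1, 2:] ^ (2 * k + r + 3)"

text \<open>
  \<open>Root\<close> is \<open>v\<^sub>0\<close>, \<open>Child i\<close> is \<open>v\<^sub>i\<close>, and the \<open>j\<close>-th arm at \<open>v\<^sub>i\<close> is the path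
  \<open>Child i\<close>, \<open>ArmA i j\<close>, \<open>ArmB i j\<close>.
\<close>

datatype vertex = Root | Child nat | ArmA nat nat | ArmB nat nat

definition num_arms :: "nat \<Rightarrow> nat \<Rightarrow> nat \<Rightarrow> nat \<Rightarrow> nat" where
  "num_arms l m n i = (if i = 1 then l else if i = 2 then m else n)"

definition T_edges :: "nat \<Rightarrow> nat \<Rightarrow> nat \<Rightarrow> (vertex \<times> vertex) set" where
  "T_edges l m n =
     {(Root, Child i) | i. i \<in> {1..3}} \<union>
     {(Child i, ArmA i j) | i j. i \<in> {1..3} \<and> j \<in> {1..num_arms l m n i}} \<union>
     {(ArmA i j, ArmB i j) | i j. i \<in> {1..3} \<and> j \<in> {1..num_arms l m n i}}"

definition T_tree :: "nat \<Rightarrow> nat \<Rightarrow> nat \<Rightarrow> vertex pair_pre_digraph" where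
  "T_tree l m n =
     \<lparr> pverts =
         {Root} \<union> {Child i | i. i \<in> {1..3}} \<union>
         {ArmA i j | i j. i \<in> {1..3} \<and> j \<in> {1..num_arms l m n i}} \<union>
         {ArmB i j | i j. i \<in> {1..3} \<and> j \<in> {1..num_arms l m n i}},
       parcs = T_edges l m n \<union> (T_edges l m n)\<inverse> \<rparr>"

definition add_edge :: "'a \<Rightarrow> 'a \<Rightarrow> 'a pair_pre_digraph \<Rightarrow> 'a pair_pre_digraph" where
  "add_edge u v G = G\<lparr> parcs := parcs G \<union> {(u, v), (v, u)} \<rparr>"

text \<open>The vertex \<open>ArmA 2 1\<close> exists only for \<open>k \<ge> 1\<close>.\<close>

definition U_graph :: "nat \<Rightarrow> nat \<Rightarrow> vertex pair_pre_digraph" where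
  "U_graph k r = add_edge (Child 1) (ArmA 2 1) (T_tree 3 k (k + r))"

lemma pair_graph_T_tree: "pair_graph (T_tree l m n)"
proof -
  let ?V = "pverts (T_tree l m n)" and ?A = "parcs (T_tree l m n)"
  have "?V \<subseteq> {Root} \<union> Child ` {1..3} \<union>
      (\<Union>i\<in>{1..3}. ArmA i ` {1..num_arms l m n i}) \<union>
      (\<Union>i\<in>{1..3}. ArmB i ` {1..num_arms l m n i})"
    by (auto simp: T_tree_def)
  then have fin: "finite ?V"
    by (rule finite_subset) auto
  have sub: "?A \<subseteq> ?V \<times> ?V"
    by (auto simp: T_tree_def T_edges_def)
  then have finA: "finite ?A"
    using fin finite_subset by blast
  have "sym ?A"
    by (auto simp: T_tree_def sym_def)
  moreover have "fst e \<noteq> snd e" if "e \<in> ?A" for e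
    using that by (auto simp: T_tree_def T_edges_def)
  ultimately show ?thesis
    using fin finA sub by unfold_locales (auto simp: symmetric_def)
qed

lemma pair_graph_U_graph:
  assumes "k \<ge> 1"
  shows "pair_graph (U_graph k r)"
proof -
  interpret T: pair_graph "T_tree 3 k (k + r)"
    by (rule pair_graph_T_tree)
  have "Child 1 \<in> pverts (T_tree 3 k (k + r))" "ArmA 2 1 \<in> pverts (T_tree 3 k (k + r))"
    using assms by (auto simp: T_tree_def num_arms_def)
  moreover have "sym (parcs (T_tree 3 k (k + r)))"
    using T.pair_sym_arcs by (simp add: symmetric_def)
  ultimately show ?thesis
    using T.pair_finite_verts T.pair_finite_arcs T.pair_no_loops
    by unfold_locales
      (auto simp: U_graph_def add_edge_def symmetric_def sym_def
        dest: T.in_arcsD1 T.in_arcsD2)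
qed

end

theory Submission
  imports Defs
begin

text \<open>
  Deleting the root splits \<open>I(U)\<close> into the independent sets that contain it, which leave only
  edges \<open>a b\<close> and contribute \<open>E\<close>, and those that avoid it, which contribute \<open>F\<^sub>k\<^sub>+\<^sub>r\<close> times the
  polynomial of the component of \<open>v\<^sub>1\<close> and \<open>v\<^sub>2\<close>. In that component, deleting the end
  \<open>a\<^sub>2\<^sub>1\<close> of the extra edge gives \<open>G\<^sub>k\<close>. The consecutive coefficients of \<open>E\<close> satisfy
  \<open>i e\<^sub>i\<^sub>+\<^sub>1 = 2 (N + 1 - i) e\<^sub>i\<close> with \<open>N = 2 k + r + 3\<close>, so they increase strictly while
  \<open>3 i < 2 N + 2\<close> and decrease strictly once \<open>3 i > 2 N + 2\<close>; as \<open>m = \<lfloor>(2 N + 2) / 3\<rfloor>\<close>,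
  both \<open>H\<close> and \<open>E\<close> increase up to \<open>m\<close> and decrease from \<open>m + 1\<close> on.
\<close>

section \<open>Independence polynomials of induced subgraphs\<close>

text \<open>
  Keeping the arc relation fixed while the vertex set shrinks makes all induced subgraphs of a
  graph available without constructing them.
\<close>

definition indep_sets :: "('a \<times> 'a) set \<Rightarrow> 'a set \<Rightarrow> 'a set set" where
  "indep_sets R V = {S. S \<subseteq> V \<and> (\<forall>u\<in>S. \<forall>v\<in>S. (u, v) \<notin> R)}"

definition indep_poly :: "('a \<times> 'a) set \<Rightarrow> 'a set \<Rightarrow> int poly" where
  "indep_poly R V = (\<Sum>S\<in>indep_sets R V. monom 1 (card S))"

lemma finite_indep_sets: "finite V \<Longrightarrow> finite (indep_sets R V)"
  unfolding indep_sets_def by (rule finite_subset[of _ "Pow V"]) auto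

text \<open>Grouping the independent sets by size turns a sum over sets into a sum over sizes; no
  size exceeds the number of vertices.\<close>

lemma independence_poly_eq_indep_poly:
  assumes "finite (pverts G)"
  shows "independence_poly G = indep_poly (parcs G) (pverts G)"
proof -
  let ?V = "pverts G" and ?I = "indep_sets (parcs G) (pverts G)"
  have fin: "finite ?I"
    using assms by (rule finite_indep_sets)
  have card_le: "card ` ?I \<subseteq> {..card ?V}"
    using assms by (auto simp: indep_sets_def intro: card_mono)
  have "indep_poly (parcs G) ?V = (\<Sum>j\<le>card ?V. \<Sum>S\<in>{S \<in> ?I. card S = j}. monom 1 (card S))"
    unfolding indep_poly_def by (rule sum.group[symmetric]) (use fin card_le in auto)
  also have "\<dots> = (\<Sum>j\<le>card ?V. monom (int (num_independent_sets G j)) j)"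
  proof (rule sum.cong[OF refl])
    fix j
    have "{S \<in> ?I. card S = j} = {S. independent_set G S \<and> card S = j}"
      by (auto simp: indep_sets_def independent_set_def)
    then show "(\<Sum>S\<in>{S \<in> ?I. card S = j}. monom (1::int) (card S)) =
        monom (int (num_independent_sets G j)) j"
      by (simp add: num_independent_sets_def of_nat_poly smult_monom)
  qed
  finally show ?thesis
    by (simp add: independence_poly_def)
qed

lemma indep_poly_empty [simp]: "indep_poly R {} = 1"
proof -
  have "indep_sets R {} = {{}}"
    by (auto simp: indep_sets_def)
  then show ?thesis
    by (simp add: indep_poly_def)
qed

text \<open>Independent sets avoiding \<open>v\<close> live on \<open>V - {v}\<close>. Those
  containing \<open>v\<close> arise by adding \<open>v\<close> to an independent set outside its
  closed neighbourhood, which raises the size by one and gives the factor x.\<close>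

lemma indep_poly_remove:
  assumes "finite V" "v \<in> V" "sym R" "(v, v) \<notin> R"
  shows "indep_poly R V =
    indep_poly R (V - {v}) + [:0, 1:] * indep_poly R (V - {v} - {u. (v, u) \<in> R})"
proof -
  let ?W = "V - {v} - {u. (v, u) \<in> R}"
  have split: "indep_sets R V = indep_sets R (V - {v}) \<union> insert v ` indep_sets R ?W"
  proof (intro equalityI subsetI)
    fix S assume S: "S \<in> indep_sets R V"
    show "S \<in> indep_sets R (V - {v}) \<union> insert v ` indep_sets R ?W"
    proof (cases "v \<in> S")
      case True
      then have "S - {v} \<in> indep_sets R ?W" "S = insert v (S - {v})"
        using S by (auto simp: indep_sets_def)
      then show ?thesis by blast
    next
      case False
      then show ?thesis
        using S by (auto simp: indep_sets_def)
    qed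
  next
    fix S assume "S \<in> indep_sets R (V - {v}) \<union> insert v ` indep_sets R ?W"
    then show "S \<in> indep_sets R V"
      using assms(2-4) by (auto simp: indep_sets_def sym_def)
  qed
  have inj: "inj_on (insert v) (indep_sets R ?W)"
    unfolding indep_sets_def by (rule inj_onI) blast
  have "(\<Sum>S\<in>insert v ` indep_sets R ?W. monom (1::int) (card S)) =
      (\<Sum>S\<in>indep_sets R ?W. [:0, 1:] * monom 1 (card S))"
    unfolding sum.reindex[OF inj] o_def
  proof (rule sum.cong[OF refl])
    fix S assume "S \<in> indep_sets R ?W"
    then have "finite S" "v \<notin> S"
      using assms(1) finite_subset by (auto simp: indep_sets_def)
    then show "monom (1::int) (card (insert v S)) = [:0, 1:] * monom 1 (card S)"
      by (simp add: monom_Suc)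
  qed
  moreover have "indep_poly R V = (\<Sum>S\<in>indep_sets R (V - {v}). monom 1 (card S)) +
      (\<Sum>S\<in>insert v ` indep_sets R ?W. monom 1 (card S))"
    unfolding indep_poly_def split
    by (rule sum.union_disjoint) (use assms(1) in \<open>auto simp: finite_indep_sets indep_sets_def\<close>)
  ultimately show ?thesis
    by (simp add: indep_poly_def sum_distrib_left)
qed

text \<open>Without edges between the two parts, an independent set is the same as an arbitrary pair
  of its traces on \<open>V\<close> and \<open>W\<close>, and sizes add.\<close>

lemma indep_poly_union:
  assumes "finite V" "finite W" "V \<inter> W = {}"
    and "\<And>v w. v \<in> V \<Longrightarrow> w \<in> W \<Longrightarrow> (v, w) \<notin> R \<and> (w, v) \<notin> R"
  shows "indep_poly R (V \<union> W) = indep_poly R V * indep_poly R W"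
proof -
  let ?I = "indep_sets R V" and ?J = "indep_sets R W"
  have bij: "bij_betw (\<lambda>(S, T). S \<union> T) (?I \<times> ?J) (indep_sets R (V \<union> W))"
  proof (rule bij_betw_byWitness[where f' = "\<lambda>S. (S \<inter> V, S \<inter> W)"])
    show "\<forall>p\<in>?I \<times> ?J. ((case p of (S, T) \<Rightarrow> S \<union> T) \<inter> V, (case p of (S, T) \<Rightarrow> S \<union> T) \<inter> W) = p"
      using assms(3) by (auto simp: indep_sets_def)
    show "\<forall>S\<in>indep_sets R (V \<union> W). (case (S \<inter> V, S \<inter> W) of (S, T) \<Rightarrow> S \<union> T) = S"
      by (auto simp: indep_sets_def)
    show "(\<lambda>(S, T). S \<union> T) ` (?I \<times> ?J) \<subseteq> indep_sets R (V \<union> W)"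
      using assms(4) by (auto simp: indep_sets_def) blast+
    show "(\<lambda>S. (S \<inter> V, S \<inter> W)) ` indep_sets R (V \<union> W) \<subseteq> ?I \<times> ?J"
      by (auto simp: indep_sets_def)
  qed
  have card: "card (S \<union> T) = card S + card T" if "S \<in> ?I" "T \<in> ?J" for S T
    using that assms(1-3) finite_subset
    by (intro card_Un_disjoint) (auto simp: indep_sets_def)
  have "indep_poly R (V \<union> W) = (\<Sum>(S, T)\<in>?I \<times> ?J. monom 1 (card (S \<union> T)))"
    unfolding indep_poly_def sum.reindex_bij_betw[OF bij, symmetric]
    by (simp add: case_prod_unfold)
  also have "\<dots> = (\<Sum>(S, T)\<in>?I \<times> ?J. monom 1 (card S) * monom 1 (card T))"
    by (rule sum.cong[OF refl]) (auto simp: card mult_monom)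
  also have "\<dots> = indep_poly R V * indep_poly R W"
    by (simp add: indep_poly_def sum_product sum.cartesian_product)
  finally show ?thesis .
qed

lemma indep_poly_singleton:
  assumes "sym R" "(v, v) \<notin> R"
  shows "indep_poly R {v} = [:1, 1:]"
  by (subst indep_poly_remove[of _ v]) (use assms in \<open>auto simp: one_pCons\<close>)

lemma indep_poly_edge:
  assumes "sym R" "(v, v) \<notin> R" "(w, w) \<notin> R" "(v, w) \<in> R"
  shows "indep_poly R {v, w} = [:1, 2:]"
proof -
  have "v \<noteq> w"
    using assms by auto
  then have "{v, w} - {v} = {w}" "{v, w} - {v} - {u. (v, u) \<in> R} = {}"
    using assms by auto
  then show ?thesis
    by (subst indep_poly_remove[of _ v]) (use assms in \<open>auto simp: indep_poly_singleton\<close>)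
qed

section \<open>The independence polynomial of \<open>U_graph k r\<close>\<close>

text \<open>The arms are given by an index set, not by a number, because deleting
  \<open>ArmA 2 1\<close> leaves the arms \<open>{2..k}\<close>. The vertex \<open>Child i\<close>
  is left out.\<close>

definition arms :: "nat \<Rightarrow> nat set \<Rightarrow> vertex set" where
  "arms i J = ArmA i ` J \<union> ArmB i ` J"

lemma finite_arms: "finite J \<Longrightarrow> finite (arms i J)"
  by (simp add: arms_def)

context
  fixes k r :: nat and R :: "(vertex \<times> vertex) set"
  assumes k: "k \<ge> 1"
  defines "R \<equiv> parcs (U_graph k r)"
begin

private lemma sym_R: "sym R"
  and irrefl_R: "(v, v) \<notin> R"
  by (auto simp: R_def U_graph_def add_edge_def T_tree_def T_edges_def sym_def)

text \<open>Neighbourhoods by type of vertex, so that adjacency conditions reduce to cases on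
  constructors. The last disjuncts for \<open>Child\<close> and \<open>ArmA\<close> are the extra
  edge.\<close>

private lemma R_simps:
  "(Root, x) \<in> R \<longleftrightarrow> (\<exists>i\<in>{1..3}. x = Child i)"
  "(Child i, x) \<in> R \<longleftrightarrow>
    i \<in> {1..3} \<and> (x = Root \<or> (\<exists>j\<in>{1..num_arms 3 k (k + r) i}. x = ArmA i j)) \<or>
    i = 1 \<and> x = ArmA 2 1"
  "(ArmA i j, x) \<in> R \<longleftrightarrow>
    i \<in> {1..3} \<and> j \<in> {1..num_arms 3 k (k + r) i} \<and> (x = Child i \<or> x = ArmB i j) \<or>
    i = 2 \<and> j = 1 \<and> x = Child 1"
  "(ArmB i j, x) \<in> R \<longleftrightarrow>
    i \<in> {1..3} \<and> j \<in> {1..num_arms 3 k (k + r) i} \<and> x = ArmA i j"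
  unfolding R_def U_graph_def add_edge_def T_tree_def T_edges_def by auto

text \<open>Without their child, the arms are disjoint edges, each contributing a factor 1 +
  2x.\<close>

private lemma indep_poly_arms:
  assumes "i \<in> {1..3}" "J \<subseteq> {1..num_arms 3 k (k + r) i}"
  shows "indep_poly R (arms i J) = [:1, 2:] ^ card J"
proof -
  have "finite J"
    using assms(2) finite_subset by blast
  then show ?thesis
    using assms(2)
  proof (induction J rule: finite_induct)
    case empty
    then show ?case by (simp add: arms_def)
  next
    case (insert j J)
    have "arms i (insert j J) = {ArmA i j, ArmB i j} \<union> arms i J"
      by (auto simp: arms_def)
    moreover have "indep_poly R ({ArmA i j, ArmB i j} \<union> arms i J) =
        indep_poly R {ArmA i j, ArmB i j} * indep_poly R (arms i J)"
      using insert.hyps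
      by (intro indep_poly_union) (auto simp: finite_arms arms_def R_simps)
    moreover have "indep_poly R {ArmA i j, ArmB i j} = [:1, 2:]"
      using insert.prems assms(1)
      by (intro indep_poly_edge sym_R irrefl_R) (auto simp: R_simps)
    ultimately show ?case
      using insert by simp
  qed
qed

private lemma indep_poly_ArmB:
  assumes "finite J"
  shows "indep_poly R (ArmB i ` J) = [:1, 1:] ^ card J"
  using assms
proof (induction J rule: finite_induct)
  case (insert j J)
  have "indep_poly R ({ArmB i j} \<union> ArmB i ` J) = indep_poly R {ArmB i j} * indep_poly R (ArmB i ` J)"
    using insert.hyps by (intro indep_poly_union) (auto simp: R_simps)
  then show ?case
    using insert by (simp add: indep_poly_singleton sym_R irrefl_R)
qed simp

text \<open>Delete \<open>Child i\<close>: either whole arms remain, or only the isolated ends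
  \<open>ArmB i j\<close>. Thus \<open>F_poly t\<close> belongs to a vertex with t arms. The extra
  edge has at most one end in this set.\<close>

private lemma indep_poly_child_arms:
  assumes "i \<in> {1..3}" "J \<subseteq> {1..num_arms 3 k (k + r) i}"
  shows "indep_poly R (insert (Child i) (arms i J)) = F_poly (card J)"
proof -
  have fin: "finite J"
    using assms(2) finite_subset by blast
  have "insert (Child i) (arms i J) - {Child i} = arms i J"
    "insert (Child i) (arms i J) - {Child i} - {u. (Child i, u) \<in> R} = ArmB i ` J"
    using assms by (auto simp: arms_def R_simps)
  then show ?thesis
    using indep_poly_remove[of "insert (Child i) (arms i J)" "Child i" R] fin assms
    by (simp add: finite_arms sym_R irrefl_R indep_poly_arms indep_poly_ArmB F_poly_def)
qed

lemma independence_poly_U_graph: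
  "independence_poly (U_graph k r) = H_poly k r + E_poly k r"
proof -
  let ?n = "k + r"
  define C1 C2 C3 where C_def: "C1 = insert (Child 1) (arms 1 {1..3})"
    "C2 = insert (Child 2) (arms 2 {1..k})" "C3 = insert (Child 3) (arms 3 {1..?n})"
  define V where "V = pverts (U_graph k r)"
  have fin: "finite C1" "finite C2" "finite C3"
    by (auto simp: C_def finite_arms)
  have three: "{1..3} = {1, 2, 3::nat}" by auto
  have V_eq: "V = insert Root (C1 \<union> C2 \<union> C3)"
  proof -
    have "V = {Root} \<union> Child ` {1..3} \<union> (\<Union>i\<in>{1..3}. arms i {1..num_arms 3 k ?n i})"
      unfolding V_def U_graph_def add_edge_def T_tree_def arms_def by auto
    then show ?thesis
      unfolding three by (simp add: C_def num_arms_def) blast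
  qed
  have "V - {Root} = (C1 \<union> C2) \<union> C3"
    by (auto simp: V_eq C_def arms_def)
  moreover have "V - {Root} - {u. (Root, u) \<in> R} = arms 1 {1..3} \<union> arms 2 {1..k} \<union> arms 3 {1..?n}"
    by (auto simp: V_eq C_def arms_def R_simps)
  \<comment> \<open>The extra edge has lost its end \<open>Child 1\<close>, so 3 + k + (k + r)
    disjoint edges remain.\<close>
  moreover have "indep_poly R (arms 1 {1..3} \<union> arms 2 {1..k} \<union> arms 3 {1..?n}) =
      [:1, 2:] ^ (2 * k + r + 3)"
  proof -
    have "indep_poly R (arms 1 {1..3} \<union> arms 2 {1..k} \<union> arms 3 {1..?n}) =
        indep_poly R (arms 1 {1..3} \<union> arms 2 {1..k}) * indep_poly R (arms 3 {1..?n})"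
      by (rule indep_poly_union) (auto simp: finite_arms arms_def R_simps)
    also have "indep_poly R (arms 1 {1..3} \<union> arms 2 {1..k}) =
        indep_poly R (arms 1 {1..3}) * indep_poly R (arms 2 {1..k})"
      by (rule indep_poly_union) (auto simp: finite_arms arms_def R_simps)
    finally show ?thesis
      by (simp add: indep_poly_arms num_arms_def flip: power_add)
         (simp add: algebra_simps)
  qed
  \<comment> \<open>With the root gone, no edge joins \<open>C3\<close> to the rest, while the extra
    edge ties \<open>C1\<close> to \<open>C2\<close>.\<close>
  moreover have "indep_poly R ((C1 \<union> C2) \<union> C3) = indep_poly R (C1 \<union> C2) * F_poly ?n"
  proof -
    have "indep_poly R ((C1 \<union> C2) \<union> C3) = indep_poly R (C1 \<union> C2) * indep_poly R C3"
      using fin by (intro indep_poly_union) (auto simp: C_def arms_def R_simps)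
    then show ?thesis
      by (simp add: C_def indep_poly_child_arms num_arms_def)
  qed
  moreover have "indep_poly R (C1 \<union> C2) = G_poly k"
  proof -
    \<comment> \<open>Deleting \<open>?a\<close> separates \<open>C1\<close>, the vertex
      \<open>Child 2\<close> with its other k - 1 arms, and the isolated vertex \<open>?b\<close>.
      Deleting also its neighbours \<open>Child 1\<close>, \<open>Child 2\<close> and
      \<open>?b\<close> leaves 3 + (k - 1) disjoint edges.\<close>
    let ?a = "ArmA 2 1" and ?b = "ArmB 2 1"
    let ?D = "insert (Child 2) (arms 2 {2..k})"
    have "C1 \<union> C2 - {?a} = (C1 \<union> ?D) \<union> {?b}"
      using k by (auto simp: C_def arms_def)
    moreover have "C1 \<union> C2 - {?a} - {u. (?a, u) \<in> R} = arms 1 {1..3} \<union> arms 2 {2..k}"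
      using k by (auto simp: C_def arms_def R_simps num_arms_def)
    moreover have "?a \<in> C1 \<union> C2"
      using k by (auto simp: C_def arms_def)
    moreover have "indep_poly R ((C1 \<union> ?D) \<union> {?b}) = F_poly 3 * F_poly (k - 1) * [:1, 1:]"
    proof -
      have "indep_poly R ((C1 \<union> ?D) \<union> {?b}) = indep_poly R (C1 \<union> ?D) * indep_poly R {?b}"
        using fin by (intro indep_poly_union) (auto simp: C_def arms_def R_simps)
      also have "indep_poly R (C1 \<union> ?D) = indep_poly R C1 * indep_poly R ?D"
        using fin by (intro indep_poly_union) (auto simp: C_def arms_def R_simps)
      finally show ?thesis
        by (simp add: C_def indep_poly_child_arms num_arms_def indep_poly_singleton sym_R irrefl_R)
    qed
    moreover have "indep_poly R (arms 1 {1..3} \<union> arms 2 {2..k}) = [:1, 2:] ^ 3 * [:1, 2:] ^ (k - 1)"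
    proof -
      have "indep_poly R (arms 1 {1..3} \<union> arms 2 {2..k}) =
          indep_poly R (arms 1 {1..3}) * indep_poly R (arms 2 {2..k})"
        by (rule indep_poly_union) (auto simp: finite_arms arms_def R_simps)
      then show ?thesis
        by (simp add: indep_poly_arms num_arms_def)
    qed
    ultimately have "indep_poly R (C1 \<union> C2) = F_poly 3 * F_poly (k - 1) * [:1, 1:] +
        [:0, 1:] * ([:1, 2:] ^ 3 * [:1, 2:] ^ (k - 1))"
      using indep_poly_remove[of "C1 \<union> C2" ?a R] fin by (simp add: sym_R irrefl_R)
    also have "\<dots> = G_poly k"
    proof -
      obtain l where l: "k = Suc l"
        using k by (cases k) auto
      \<comment> \<open>The formula for \<open>G_poly\<close> has the shape given by deleting
        \<open>Child 2\<close>, where the first arm at \<open>Child 2\<close> becomes a fourth arm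
        at \<open>Child 1\<close>. Both expansions agree because 1 + 2x = (1 + x) + x.\<close>
      have "(a ^ 3 + x * b ^ 3) * (a ^ l + x * b ^ l) * b + x * (a ^ 3 * a ^ l) =
          (a ^ 4 + x * b ^ 4) * a ^ l + x * b ^ Suc l * (a ^ 3 + x * b ^ 3)"
        if "a = b + x" for a b x :: "int poly"
      proof -
        have "a ^ 4 = (b + x) * a ^ 3" "b ^ 4 = b * b ^ 3"
          by (simp_all add: that power3_eq_cube power4_eq_xxxx)
        then show ?thesis
          by (simp only: power_Suc ring_distribs ac_simps)
      qed
      from this[of "[:1, 2:]" "[:1, 1:]" "[:0, 1:]"] show ?thesis
        by (simp only: G_poly_def F_poly_def l diff_Suc_1) simp
    qed
    finally show ?thesis .
  qed
  ultimately have "indep_poly R V = H_poly k r + E_poly k r"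
    using indep_poly_remove[of V Root R] fin
    by (simp add: V_eq sym_R irrefl_R H_poly_def E_poly_def)
  moreover have "finite V"
    using fin by (simp add: V_eq)
  ultimately show ?thesis
    by (simp add: independence_poly_eq_indep_poly V_def R_def)
qed

end

section \<open>Monotonicity of the coefficients of \<open>E_poly\<close>\<close>

lemma coeff_E_poly_Suc:
  "coeff (E_poly k r) (Suc i) = int ((2 * k + r + 3) choose i) * 2 ^ i"
proof (cases "i \<le> 2 * k + r + 3")
  case True
  then show ?thesis
    by (simp add: E_poly_def coeff_linear_poly_power)
next
  case False
  then have "coeff ([:1, 2::int:] ^ (2 * k + r + 3)) i = 0"
    by (intro coeff_eq_0) (simp add: degree_power_eq)
  with False show ?thesis
    by (simp add: E_poly_def)
qed

lemma coeff_E_poly_0 [simp]: "coeff (E_poly k r) 0 = 0"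
  by (simp add: E_poly_def)

lemma degree_E_poly: "degree (E_poly k r) = 2 * k + r + 4"
  by (simp add: E_poly_def degree_mult_eq degree_power_eq)

lemma coeff_E_poly_nonneg: "0 \<le> coeff (E_poly k r) i"
  by (cases i) (simp_all add: coeff_E_poly_Suc)

lemma coeff_E_poly_pos:
  assumes "0 < i" "i \<le> 2 * k + r + 4"
  shows "0 < coeff (E_poly k r) i"
  using assms by (cases i) (simp_all add: coeff_E_poly_Suc)

text \<open>This is the ratio of consecutive binomial coefficients, shifted by the factor x and
  doubled by the 2 in 1 + 2x. The bound on \<open>i\<close> keeps the subtraction
  \<open>?N - j\<close> exact; for \<open>i = 0\<close> both sides vanish.\<close>

lemma coeff_E_poly_ratio:
  assumes "i \<le> 2 * k + r + 4"
  shows "int i * coeff (E_poly k r) (Suc i) = 2 * (int (2 * k + r + 4) - int i) * coeff (E_poly k r) i"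
proof (cases i)
  case (Suc j)
  let ?N = "2 * k + r + 3"
  have "Suc j * (?N choose Suc j) = (?N - j) * (?N choose j)"
    using binomial_absorb_comp[of ?N j] binomial_absorption[of j ?N] by simp
  then have "int (Suc j) * int (?N choose Suc j) = int (?N - j) * int (?N choose j)"
    by (metis of_nat_mult)
  moreover have "int (?N - j) = int (2 * k + r + 4) - int i"
    using assms Suc by simp
  ultimately have "int i * int (?N choose Suc j) =
      (int (2 * k + r + 4) - int i) * int (?N choose j)"
    by (simp only: Suc)
  then have "2 * 2 ^ j * (int i * int (?N choose Suc j)) =
      2 * 2 ^ j * ((int (2 * k + r + 4) - int i) * int (?N choose j))"
    by (simp only:)
  then show ?thesis
    by (simp only: Suc coeff_E_poly_Suc power_Suc mult_ac)
qed simp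

text \<open>The hypothesis says that i < 2 (2k + r + 4 - i), so the ratio exceeds 1. At
  \<open>i = 0\<close> the ratio says nothing, and the coefficients are 0 and 1.\<close>

lemma coeff_E_poly_less_Suc:
  assumes "3 * i < 4 * k + 2 * r + 8"
  shows "coeff (E_poly k r) i < coeff (E_poly k r) (Suc i)"
proof (cases "i = 0")
  case False
  let ?e = "coeff (E_poly k r)"
  have "int i * ?e i < (2 * (int (2 * k + r + 4) - int i)) * ?e i"
    using assms False by (intro mult_strict_right_mono coeff_E_poly_pos) auto
  also have "\<dots> = int i * ?e (Suc i)"
    using assms by (subst coeff_E_poly_ratio) auto
  finally show ?thesis
    using False by simp
qed (simp add: coeff_E_poly_Suc)

text \<open>Here the ratio is below 1. Strictness needs a positive coefficient at \<open>i\<close>,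
  hence the bound by the degree.\<close>

lemma coeff_E_poly_Suc_less:
  assumes "4 * k + 2 * r + 8 < 3 * i" "i \<le> 2 * k + r + 4"
  shows "coeff (E_poly k r) (Suc i) < coeff (E_poly k r) i"
proof -
  let ?e = "coeff (E_poly k r)"
  have "int i * ?e (Suc i) < int i * ?e i"
    unfolding coeff_E_poly_ratio[OF assms(2)] using assms
    by (intro mult_strict_right_mono coeff_E_poly_pos) auto
  then show ?thesis
    using assms(1) by simp
qed

text \<open>The tie, possible only when 3 divides 4k + 2r + 8: the ratio is exactly 1.\<close>

lemma coeff_E_poly_Suc_eq:
  assumes "4 * k + 2 * r + 8 = 3 * i"
  shows "coeff (E_poly k r) (Suc i) = coeff (E_poly k r) i"
proof -
  let ?e = "coeff (E_poly k r)"
  have i: "0 < i" "i \<le> 2 * k + r + 4"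
    using assms by simp_all
  have "2 * (int (2 * k + r + 4) - int i) = int i"
    using assms by simp
  with coeff_E_poly_ratio[OF i(2)] have "int i * ?e (Suc i) = int i * ?e i"
    by (simp only:)
  then show ?thesis
    using i by simp
qed

section \<open>Unimodality of the sum\<close>

text \<open>At the degree the next coefficient is 0 and the present one nonnegative; beyond it both
  are 0. Without the degree bound, polynomials of different degrees can be compared index by
  index.\<close>

lemma unimodal_with_mode_coeff_antimono:
  assumes "unimodal_with_mode p m" "m \<le> i"
  shows "coeff p (Suc i) \<le> coeff p i"
  using assms by (cases "i < degree p"; cases "i = degree p")
    (auto simp: unimodal_with_mode_def coeff_eq_0)

lemma unimodal_with_mode_coeff_nonneg:
  assumes "unimodal_with_mode p m"
  shows "0 \<le> coeff p i"
  using assms by (cases "i \<le> degree p") (auto simp: unimodal_with_mode_def coeff_eq_0)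

theorem proposition4p9:
  fixes k r m :: nat
  assumes "r \<in> {0, 1, 2}"
    and "k \<ge> 1"
    and "m = nat \<lfloor>(4 * real k + 2 * real r + 8) / 3\<rfloor>"
    and "unimodal_with_mode (H_poly k r) m"
  shows "(\<exists>j. unimodal_with_mode (E_poly k r) j) \<and>
         (\<forall>j. unimodal_with_mode (E_poly k r) j \<longrightarrow> j \<in> {m, m + 1}) \<and>
         independence_poly (U_graph k r) = H_poly k r + E_poly k r \<and>
         (\<exists>j\<in>{m, m + 1}. unimodal_with_mode (independence_poly (U_graph k r)) j) \<and>
         (\<forall>i\<in>{m, m + 1}.
            (\<forall>j\<in>{m, m + 1}.
               coeff (independence_poly (U_graph k r)) j
                 \<le> coeff (independence_poly (U_graph k r)) i) \<longrightarrow>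
            unimodal_with_mode (independence_poly (U_graph k r)) i)"
proof -
  let ?E = "coeff (E_poly k r)" and ?H = "coeff (H_poly k r)"
  let ?I = "independence_poly (U_graph k r)"
  have I: "?I = H_poly k r + E_poly k r"
    using assms(2) by (rule independence_poly_U_graph)
  have m: "m = (4 * k + 2 * r + 8) div 3"
  proof -
    have "(4 * real k + 2 * real r + 8) / 3 = real (4 * k + 2 * r + 8) / real 3"
      by simp
    then show ?thesis
      unfolding assms(3) by (simp only: floor_divide_of_nat_eq nat_int)
  qed
  have E_up: "?E i < ?E (Suc i)" if "i < m" for i
    using that m by (intro coeff_E_poly_less_Suc) linarith
  have E_up_m: "?E m \<le> ?E (Suc m)"
  proof (cases "4 * k + 2 * r + 8 = 3 * m")
    case True
    then show ?thesis
      by (simp add: coeff_E_poly_Suc_eq)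
  next
    case False
    then show ?thesis
      using m by (intro less_imp_le coeff_E_poly_less_Suc) linarith
  qed
  have E_down: "?E (Suc i) < ?E i" if "m < i" "i \<le> 2 * k + r + 4" for i
    using that m by (intro coeff_E_poly_Suc_less) linarith+
  have m_le: "m + 1 \<le> 2 * k + r + 4"
    using m assms(2) by linarith
  \<comment> \<open>The index \<open>m + 1\<close> is always a mode, since the step from
    \<open>m\<close> to \<open>m + 1\<close> never goes down.\<close>
  have E_mode: "unimodal_with_mode (E_poly k r) (m + 1)"
    using E_up E_up_m E_down m_le
    by (auto simp: unimodal_with_mode_def degree_E_poly coeff_E_poly_nonneg less_Suc_eq
        intro: less_imp_le)
  have E_modes: "j \<in> {m, m + 1}" if j: "unimodal_with_mode (E_poly k r) j" for j
  proof (rule ccontr)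
    assume "j \<notin> {m, m + 1}"
    \<comment> \<open>A mode below \<open>m\<close> contradicts the strict rise just after it, a
      mode above \<open>m + 1\<close> the strict fall just before it.\<close>
    then consider "j < m" | i where "j = Suc i" "m < i"
      by (cases j) (auto, linarith)
    then show False
    proof cases
      case 1
      then have "?E (Suc j) \<le> ?E j"
        using j m_le by (auto simp: unimodal_with_mode_def degree_E_poly)
      then show False
        using E_up[OF 1] by simp
    next
      case (2 i)
      then have "?E i \<le> ?E (Suc i)" "i \<le> 2 * k + r + 4"
        using j by (auto simp: unimodal_with_mode_def degree_E_poly)
      then show False
        using E_down[of i] 2 by simp
    qed
  qed
  have nonneg: "0 \<le> coeff ?I i" for i
    unfolding I using unimodal_with_mode_coeff_nonneg[OF assms(4)]
    by (simp add: coeff_E_poly_nonneg)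
  have up: "coeff ?I i \<le> coeff ?I (Suc i)" if "i < m" for i
    using that assms(4) E_up[of i] by (auto simp: I unimodal_with_mode_def intro!: add_mono)
  have down: "coeff ?I (Suc i) \<le> coeff ?I i" if "m < i" for i
    using that unimodal_with_mode_coeff_antimono[OF assms(4), of i]
      unimodal_with_mode_coeff_antimono[OF E_mode, of i]
    by (simp add: I add_mono)
  \<comment> \<open>A mode may not exceed the degree; a positive coefficient at \<open>m + 1\<close>
    places both candidates within it.\<close>
  have "0 < coeff ?I (m + 1)"
    unfolding I coeff_add using coeff_E_poly_pos[of "m + 1" k r] m_le
      unimodal_with_mode_coeff_nonneg[OF assms(4), of "m + 1"] by linarith
  then have deg: "m + 1 \<le> degree ?I"
    by (intro le_degree) simp
  \<comment> \<open>Only the step from \<open>m\<close> to \<open>m + 1\<close> has unknown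
    direction, and the choice of \<open>i\<close> as an index of the larger coefficient settles it;
    this is the case \<open>l = m\<close> below.\<close>
  have larger_mode: "unimodal_with_mode ?I i"
    if "i \<in> {m, m + 1}" "\<forall>j\<in>{m, m + 1}. coeff ?I j \<le> coeff ?I i" for i
    unfolding unimodal_with_mode_def
  proof (intro conjI allI impI nonneg)
    show "i \<le> degree ?I"
      using that(1) deg by auto
    show "coeff ?I l \<le> coeff ?I (Suc l)" if "l < i" for l
      using that \<open>i \<in> {m, m + 1}\<close> \<open>\<forall>j\<in>{m, m + 1}. coeff ?I j \<le> coeff ?I i\<close> up[of l]
      by (cases "l = m") auto
    show "coeff ?I (Suc l) \<le> coeff ?I l" if "i \<le> l \<and> l < degree ?I" for l
      using that \<open>i \<in> {m, m + 1}\<close> \<open>\<forall>j\<in>{m, m + 1}. coeff ?I j \<le> coeff ?I i\<close> down[of l]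
      by (cases "l = m") auto
  qed
  have "\<exists>i\<in>{m, m + 1}. \<forall>j\<in>{m, m + 1}. coeff ?I j \<le> coeff ?I i"
    using linear[of "coeff ?I m" "coeff ?I (m + 1)"] by auto
  then have "\<exists>j\<in>{m, m + 1}. unimodal_with_mode ?I j"
    using larger_mode by blast
  then show ?thesis
    using E_mode E_modes I larger_mode by blast
qed

end
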